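(* Let $n\ge 1$ be an integer, let $a_0,a_1,\ldots,a_{n-1}$ be independent standard normal $N(0,1)$ random variables, and let $$P(z)=z^n+a_{n-1}z^{n-1}+\cdots+a_1z+a_0$$ be the corresponding random monic polynomial of degree $n$. Then for every real number $c>0$, $$\mathbb{P}\bigl(\text{all complex roots of } P \text{ lie in the disc } |z|\le c\bigr)\le \operatorname{erf}\!\left(\frac{c^n}{\sqrt{2}}\right).$$
   Context: The error function is $\operatorname{erf}(x)=\frac{2}{\sqrt{\pi}}\int_0^x e^{-t^2}\,dt$. The probability is taken with respect to the law of the random coefficients. *)

theory Defs
  imports "HOL-Probability.Probability" "HOL-Computational_Algebra.Polynomial"
begin

text \<open>The interval integral is oriented, so the formula is the usual one for negative \<open>x\<close> too.\<close>

definition erf :: "real \<Rightarrow> real" where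
  "erf x = 2 / sqrt pi * (LBINT t=ereal 0..ereal x. exp (- (t\<^sup>2)))"

definition monic_poly :: "nat \<Rightarrow> (nat \<Rightarrow> real) \<Rightarrow> complex poly" where
  "monic_poly n a = monom 1 n + (\<Sum>i<n. monom (complex_of_real (a i)) i)"

end

theory Submission
  imports Defs "HOL-Computational_Algebra.Fundamental_Theorem_Algebra"
begin

text \<open>
  Up to sign, the constant coefficient of a monic polynomial is the product of its roots. If all
  \<open>n\<close> roots of the random polynomial lie in the disc of radius \<open>c\<close>, this forces
  \<open>\<bar>a\<^sub>0\<bar> \<le> c ^ n\<close> (lemma \<open>norm_coeff_0_le_of_norm_roots_le\<close>). So the event in question is
  contained in one that concerns only the single standard normal variable \<open>a\<^sub>0\<close>, and that event
  has probability \<open>erf (c ^ n / sqrt 2)\<close> exactly (lemma \<open>prob_abs_std_normal_le\<close>).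
\<close>

text \<open>Vieta: the constant coefficient is the product of the negated roots, counted with
  multiplicity, and by the fundamental theorem of algebra there are \<open>degree p\<close> of them.\<close>

lemma norm_coeff_0_le_of_norm_roots_le:
  fixes p :: "complex poly"
  assumes "lead_coeff p = 1" and "\<And>z. poly p z = 0 \<Longrightarrow> norm z \<le> c"
  shows "norm (coeff p 0) \<le> c ^ degree p"
proof -
  have "p \<noteq> 0"
    using assms(1) by auto
  have "coeff p 0 = poly p 0"
    by (simp add: poly_0_coeff_0)
  also have "\<dots> = poly (\<Prod>x\<in>#proots p. [:-x, 1:]) 0"
    using complex_poly_decompose_multiset[of p] assms(1) by simp
  also have "\<dots> = (\<Prod>x\<in>#proots p. - x)"
    by (simp add: poly_prod_mset image_mset.compositionality o_def)
  finally have coeff_eq: "coeff p 0 = (\<Prod>x\<in>#proots p. - x)" .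
  have norm_prod_le: "norm (\<Prod>x\<in>#A. - x) \<le> c ^ size A"
    if "\<And>x. x \<in># A \<Longrightarrow> norm x \<le> c" for A :: "complex multiset"
    using that
  proof (induction A)
    case (add x A)
    \<comment> \<open>The sign of \<open>c\<close> is not assumed; any root bounded by \<open>c\<close> in norm supplies it.\<close>
    then have "0 \<le> c"
      by (metis norm_ge_zero order_trans union_single_eq_member)
    with add show ?case
      by (auto simp: norm_mult intro!: mult_mono)
  qed simp
  from norm_prod_le[of "proots p"] \<open>p \<noteq> 0\<close> assms(2) show ?thesis
    by (simp add: coeff_eq size_proots_complex)
qed

lemma coeff_monic_poly:
  "coeff (monic_poly n a) k = (if k = n then 1 else if k < n then complex_of_real (a k) else 0)"
  by (simp add: monic_poly_def coeff_sum)

lemma degree_monic_poly [simp]: "degree (monic_poly n a) = n"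
  by (rule order_antisym) (auto intro!: degree_le le_degree simp: coeff_monic_poly)

text \<open>The factor \<open>2\<close> in \<open>erf\<close> is absorbed by the evenness of \<open>exp (- t\<^sup>2)\<close>, which turns
  the integral over \<open>[0, s]\<close> into one over \<open>[-s, s]\<close>; the substitution \<open>t = x / sqrt 2\<close>
  then produces the normal density.\<close>

lemma erf_eq_integral_std_normal_density:
  assumes "0 \<le> r"
  shows "erf (r / sqrt 2) = (\<integral>x\<in>{-r..r}. std_normal_density x \<partial>lborel)"
proof -
  define s where "s = r / sqrt 2"
  have "0 \<le> s"
    using assms by (simp add: s_def)
  let ?g = "\<lambda>t::real. exp (- (t\<^sup>2))"
  have cont: "continuous_on A ?g" for A
    by (intro continuous_intros)
  have integrable: "interval_lebesgue_integrable lborel (ereal a) (ereal b) ?g" if "a \<le> b" for a b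
    using that
    by (intro interval_integrable_continuous_on) (auto intro: cont)
  have "(LBINT t=ereal (-s)..ereal 0. ?g t) = (LBINT t=ereal 0..ereal s. ?g t)"
    by (subst interval_integral_reflect) (simp add: zero_ereal_def)
  moreover have "(LBINT t=ereal (-s)..ereal 0. ?g t) + (LBINT t=ereal 0..ereal s. ?g t)
      = (LBINT t=ereal (-s)..ereal s. ?g t)"
    using \<open>0 \<le> s\<close> integrable by (intro interval_integral_sum) (simp_all add: min_def max_def)
  ultimately have "erf s = 1 / sqrt pi * (LBINT t=ereal (-s)..ereal s. ?g t)"
    by (simp add: erf_def)
  also have "\<dots> = 1 / sqrt pi * (\<integral>t\<in>{-s..s}. ?g t \<partial>lborel)"
    using \<open>0 \<le> s\<close> by (simp add: interval_integral_Icc)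
  also have "(\<integral>t\<in>{-s..s}. ?g t \<partial>lborel)
      = 1 / sqrt 2 * (\<integral>x. indicator {-s..s} (x / sqrt 2) * ?g (x / sqrt 2) \<partial>lborel)"
    unfolding set_lebesgue_integral_def
    by (subst lborel_integral_real_affine[where t = 0 and c = "1 / sqrt 2"]) simp_all
  also have "1 / sqrt pi * \<dots> = (\<integral>x\<in>{-r..r}. std_normal_density x \<partial>lborel)"
    unfolding set_lebesgue_integral_def mult.assoc[symmetric] integral_mult_right_zero[symmetric]
    by (intro Bochner_Integration.integral_cong)
       (auto simp: s_def std_normal_density_def indicator_def field_simps real_sqrt_mult)
  finally show ?thesis
    by (simp add: s_def)
qed

lemma (in prob_space) prob_abs_std_normal_le:
  assumes "distributed M lborel X std_normal_density" and "0 \<le> r"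
  shows "prob {\<omega> \<in> space M. \<bar>X \<omega>\<bar> \<le> r} = erf (r / sqrt 2)"
proof -
  have [measurable]: "X \<in> borel_measurable M"
    using assms(1) by (simp add: distributed_def)
  have "prob {\<omega> \<in> space M. \<bar>X \<omega>\<bar> \<le> r}
      = (\<integral>\<omega>. indicator {\<omega> \<in> space M. \<bar>X \<omega>\<bar> \<le> r} \<omega> \<partial>M)"
    by simp
  also have "\<dots> = (\<integral>\<omega>. indicator {-r..r} (X \<omega>) \<partial>M)"
    by (intro Bochner_Integration.integral_cong) (auto simp: indicator_def)
  also have "\<dots> = (\<integral>x. std_normal_density x * indicator {-r..r} x \<partial>lborel)"
    by (intro distributed_integral[OF assms(1), symmetric]) auto
  also have "\<dots> = erf (r / sqrt 2)"
    using assms(2) by (simp add: erf_eq_integral_std_normal_density set_lebesgue_integral_def mult.commute)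
  finally show ?thesis .
qed

theorem theorem2:
  fixes M :: "'w measure" and a :: "nat \<Rightarrow> 'w \<Rightarrow> real" and n :: nat and c :: real
  assumes "prob_space M"
    and "n \<ge> 1"
    and "prob_space.indep_vars M (\<lambda>_. borel) a {..<n}"
    and "\<And>i. i < n \<Longrightarrow> distributed M lborel (a i) std_normal_density"
    and "c > 0"
  shows "measure M {\<omega> \<in> space M. \<forall>z::complex. poly (monic_poly n (\<lambda>i. a i \<omega>)) z = 0 \<longrightarrow> norm z \<le> c}
           \<le> erf (c ^ n / sqrt 2)"
proof -
  interpret prob_space M
    by fact
  have a0: "distributed M lborel (a 0) std_normal_density"
    using assms(2,4) by simp
  then have [measurable]: "a 0 \<in> borel_measurable M"
    by (auto simp: distributed_def)
  have "\<bar>a 0 \<omega>\<bar> \<le> c ^ n"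
    if "\<forall>z::complex. poly (monic_poly n (\<lambda>i. a i \<omega>)) z = 0 \<longrightarrow> norm z \<le> c" for \<omega>
    using norm_coeff_0_le_of_norm_roots_le[of "monic_poly n (\<lambda>i. a i \<omega>)" c] that assms(2)
    by (simp add: coeff_monic_poly)
  then have "prob {\<omega> \<in> space M. \<forall>z::complex. poly (monic_poly n (\<lambda>i. a i \<omega>)) z = 0 \<longrightarrow> norm z \<le> c}
      \<le> prob {\<omega> \<in> space M. \<bar>a 0 \<omega>\<bar> \<le> c ^ n}"
    by (intro finite_measure_mono) auto
  also have "\<dots> = erf (c ^ n / sqrt 2)"
    using a0 assms(5) by (intro prob_abs_std_normal_le) simp_all
  finally show ?thesis .
qed

end
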